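(* Let $X \subseteq \mathbb{R}^L$ and let $f = (f_1,\dots,f_M): X \to \mathbb{R}^M$ be a simplicial problem. Let $X^*$ be one of the following sets: the Pareto set $X^*(f) \subseteq \mathbb{R}^L$ (put $N = L$); the Pareto front $fX^*(f) \subseteq \mathbb{R}^M$ (put $N = M$); or the graph $G^*(f) = \{(x, f(x)) \in \mathbb{R}^L \times \mathbb{R}^M : x \in X^*(f)\}$ of the objective map restricted to the Pareto set (put $N = L + M$, identifying $\mathbb{R}^L \times \mathbb{R}^M$ with $\mathbb{R}^{L+M}$). Then there exists an infinite sequence of Bézier simplices $b^{(i)}: \Delta^{M-1} \to \mathbb{R}^N$ ($i = 1, 2, \dots$) such that $$\lim_{i \to \infty} d_{\mathrm H}(X^*, B^{(i)}) = 0,$$ where $d_{\mathrm H}$ is the Hausdorff distance and $B^{(i)} := b^{(i)}(\Delta^{M-1})$ is the image of $b^{(i)}$.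
   Context: Pareto notions. For a map $g = (g_1,\dots,g_k): X \to \mathbb{R}^k$ and $x, y \in X$, write $g(x) \prec g(y)$ if $g_m(x) \le g_m(y)$ for all $m$ and $g_m(x) < g_m(y)$ for some $m$. The Pareto set of $g$ is $X^*(g) := \{x \in X : g(y) \not\prec g(x) \text{ for all } y \in X\}$. The Pareto front of $f$ is $fX^*(f) := \{f(x) : x \in X^*(f)\}$. Simplices and subproblems. Let $I := \{1,\dots,M\}$ and $\Delta^{M-1} := \{(t_1,\dots,t_M) \in \mathbb{R}^M : t_m \ge 0 \text{ for all } m,\ \sum_{m=1}^M t_m = 1\}$. For non-empty $J \subseteq I$, put $\Delta^J := \{(t_1,\dots,t_M) \in \Delta^{M-1} : t_m = 0 \text{ for } m \notin J\}$ and $f_J := (f_i)_{i \in J}: X \to \mathbb{R}^{|J|}$, and let $fX^*(f_J) := \{f(x) : x \in X^*(f_J)\} \subseteq \mathbb{R}^M$. Simplicial problem. The problem of minimizing $f: X \to \mathbb{R}^M$ (identified with the map $f$) is simplicial if there exists a map $\phi: \Delta^{M-1} \to X$ such that for each non-empty $J \subseteq I$ the restriction $\phi|_{\Delta^J}$ gives homeomorphisms $\phi|_{\Delta^J}: \Delta^J \to X^*(f_J)$ and $f \circ \phi|_{\Delta^J}: \Delta^J \to fX^*(f_J)$ (with subspace topologies from the ambient Euclidean spaces). Bézier simplices. $\mathbb{N}$ is the set of nonnegative integers. For $D \in \mathbb{N}$ put $\mathbb{N}_D^M := \{(d_1,\dots,d_M) \in \mathbb{N}^M : \sum_{m=1}^M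 d_m = D\}$; write $t^d := t_1^{d_1} \cdots t_M^{d_M}$ and $\binom{D}{d} := \frac{D!}{d_1! \cdots d_M!}$. A Bézier simplex of degree $D$ in $\mathbb{R}^N$ is a map $b: \Delta^{M-1} \to \mathbb{R}^N$ of the form $b(t) = \sum_{d \in \mathbb{N}_D^M} \binom{D}{d} t^d p_d$ with control points $p_d \in \mathbb{R}^N$. A Bézier simplex is one of some degree $D \in \mathbb{N}$; members of a sequence may have different degrees. Hausdorff distance. $d_{\mathrm H}(A,B) := \max\{\sup_{a \in A} \inf_{b \in B} |a-b|,\ \sup_{b \in B} \inf_{a \in A} |a-b|\}$, with $|\cdot|$ the Euclidean norm. *)

theory Defs
  imports "HOL-Analysis.Analysis"
begin

text \<open>
  The index set \<open>{1,\<dots>,M}\<close> is the finite type \<open>'m\<close>, so that \<open>\<real>\<^sup>M\<close> is \<open>real ^ 'm\<close>. The map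
  \<open>f\<^sub>J = (f\<^sub>i)\<^sub>i\<^sub>\<in>\<^sub>J\<close> on \<open>X\<close> is represented by \<open>f\<close> together with the set \<open>J\<close> of those
  components that are compared; \<open>f\<close> itself is the case \<open>J = UNIV\<close>.
\<close>

definition pareto_less :: "'m set \<Rightarrow> real ^ 'm \<Rightarrow> real ^ 'm \<Rightarrow> bool" where
  "pareto_less J u v \<longleftrightarrow> (\<forall>m\<in>J. u $ m \<le> v $ m) \<and> (\<exists>m\<in>J. u $ m < v $ m)"

definition pareto_set :: "'m set \<Rightarrow> 'a set \<Rightarrow> ('a \<Rightarrow> real ^ 'm) \<Rightarrow> 'a set" where
  "pareto_set J X f = {x \<in> X. \<forall>y\<in>X. \<not> pareto_less J (f y) (f x)}"

definition pareto_graph :: "'a set \<Rightarrow> ('a \<Rightarrow> real ^ 'm) \<Rightarrow> ('a \<times> (real ^ 'm)) set" where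
  "pareto_graph X f = {(x, f x) | x. x \<in> pareto_set UNIV X f}"

definition std_simplex :: "(real ^ 'm::finite) set" where
  "std_simplex = {t. (\<forall>m. 0 \<le> t $ m) \<and> (\<Sum>m\<in>UNIV. t $ m) = 1}"

definition simplex_face :: "'m set \<Rightarrow> (real ^ 'm::finite) set" where
  "simplex_face J = {t \<in> std_simplex. \<forall>m. m \<notin> J \<longrightarrow> t $ m = 0}"

definition simplicial_problem ::
    "('a::topological_space) set \<Rightarrow> ('a \<Rightarrow> real ^ 'm::finite) \<Rightarrow> bool" where
  "simplicial_problem X f \<longleftrightarrow>
    (\<exists>\<phi> \<in> std_simplex \<rightarrow> X. \<forall>J. J \<noteq> {} \<longrightarrow>
      (\<exists>\<psi>. homeomorphism (simplex_face J) (pareto_set J X f) \<phi> \<psi>) \<and>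
      (\<exists>\<psi>. homeomorphism (simplex_face J) (f ` pareto_set J X f) (f \<circ> \<phi>) \<psi>))"

definition multi_indices :: "nat \<Rightarrow> ('m::finite \<Rightarrow> nat) set" where
  "multi_indices D = {d. (\<Sum>m\<in>UNIV. d m) = D}"

lemma finite_multi_indices: "finite (multi_indices D :: ('m::finite \<Rightarrow> nat) set)"
proof (rule finite_subset)
  show "multi_indices D \<subseteq> PiE (UNIV :: 'm set) (\<lambda>_. {..D})"
    by (auto simp: multi_indices_def member_le_sum)
qed (intro finite_PiE, auto)

definition multinomial :: "nat \<Rightarrow> ('m::finite \<Rightarrow> nat) \<Rightarrow> real" where
  "multinomial D d = fact D / (\<Prod>m\<in>UNIV. fact (d m))"

definition is_bezier_simplex :: "(real ^ 'm::finite \<Rightarrow> 'b::euclidean_space) \<Rightarrow> bool" where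
  "is_bezier_simplex b \<longleftrightarrow>
    (\<exists>(D::nat) (p :: ('m \<Rightarrow> nat) \<Rightarrow> 'b). \<forall>t\<in>std_simplex.
      b t = (\<Sum>d\<in>multi_indices D. (multinomial D d * (\<Prod>m\<in>UNIV. t $ m ^ d m)) *\<^sub>R p d))"

text \<open>
  The Hausdorff distance takes values in \<open>[0,\<infinity>]\<close>, since the supremum of an unbounded set
  and the infimum of the empty set are unspecified in type \<open>real\<close>.
\<close>

definition hausdorff_distance :: "('a::metric_space) set \<Rightarrow> 'a set \<Rightarrow> ennreal" where
  "hausdorff_distance A B =
    max (SUP a\<in>A. INF b\<in>B. ennreal (dist a b)) (SUP b\<in>B. INF a\<in>A. ennreal (dist a b))"

end

theory Submission
  imports Defs
begin

text \<open>
  Pareto set, Pareto front and graph are continuous images of the standard simplex. By the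
  Stone--Weierstrass theorem the parametrisation is a uniform limit of polynomial maps, and on the
  simplex every polynomial map is a Bezier simplex: multiplying by powers of
  \<open>\<Sum>\<^sub>m t\<^sub>m = 1\<close> makes it homogeneous. Uniformly close maps have images that are
  close in the Hausdorff distance.
\<close>

section \<open>Homogeneous polynomial maps on the simplex, with their sums and products\<close>

definition monomial_at :: "('m::finite \<Rightarrow> nat) \<Rightarrow> real ^ 'm \<Rightarrow> real" where
  "monomial_at d t = (\<Prod>m\<in>UNIV. t $ m ^ d m)"

text \<open>A Bezier simplex with the multinomial factors absorbed into the coefficients
  \<open>p\<close>, so that products become plain convolutions. Agreement is required only on the
  simplex, which is what allows the degree to be raised there.\<close>

definition homogeneous_on_simplex ::
    "nat \<Rightarrow> (real ^ 'm::finite \<Rightarrow> 'b::real_vector) \<Rightarrow> bool" where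
  "homogeneous_on_simplex D g \<longleftrightarrow>
    (\<exists>p. \<forall>t\<in>std_simplex. g t = (\<Sum>d\<in>multi_indices D. monomial_at d t *\<^sub>R p d))"

lemma homogeneous_on_simplexI:
  assumes "\<And>t. t \<in> std_simplex \<Longrightarrow> g t = (\<Sum>d\<in>multi_indices D. monomial_at d t *\<^sub>R p d)"
  shows "homogeneous_on_simplex D g"
  using assms by (auto simp: homogeneous_on_simplex_def)

lemma homogeneous_on_simplexE:
  assumes "homogeneous_on_simplex D g"
  obtains p where
    "\<And>t. t \<in> std_simplex \<Longrightarrow> g t = (\<Sum>d\<in>multi_indices D. monomial_at d t *\<^sub>R p d)"
  using assms by (auto simp: homogeneous_on_simplex_def)

lemma homogeneous_on_simplex_cong:
  assumes "homogeneous_on_simplex D g" "\<And>t. t \<in> std_simplex \<Longrightarrow> g t = h t"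
  shows "homogeneous_on_simplex D h"
  using assms by (auto simp: homogeneous_on_simplex_def)

text \<open>Multinomial coefficients are nonzero, so dividing the coefficients by them yields the
  control points.\<close>

lemma homogeneous_imp_bezier_simplex:
  fixes g :: "real ^ 'm::finite \<Rightarrow> 'b::euclidean_space"
  assumes "homogeneous_on_simplex D g"
  shows "is_bezier_simplex g"
proof -
  obtain p where p:
    "\<And>t. t \<in> std_simplex \<Longrightarrow> g t = (\<Sum>d\<in>multi_indices D. monomial_at d t *\<^sub>R p d)"
    using assms by (rule homogeneous_on_simplexE) blast
  have nz: "multinomial D d \<noteq> 0" for d :: "'m \<Rightarrow> nat"
    by (simp add: multinomial_def)
  have "g t = (\<Sum>d\<in>multi_indices D.
      (multinomial D d * (\<Prod>m\<in>UNIV. t $ m ^ d m)) *\<^sub>R (p d /\<^sub>R multinomial D d))"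
    if "t \<in> std_simplex" for t
    by (simp add: p[OF that] monomial_at_def nz field_simps)
  then show ?thesis
    unfolding is_bezier_simplex_def
    by (intro exI[where x = D] exI[where x = "\<lambda>d. p d /\<^sub>R multinomial D d"] ballI)
qed

lemma homogeneous_on_simplex_0: "homogeneous_on_simplex D (\<lambda>t. 0)"
  by (rule homogeneous_on_simplexI[where p = "\<lambda>d. 0"]) simp

lemma homogeneous_on_simplex_add:
  assumes "homogeneous_on_simplex D g" "homogeneous_on_simplex D h"
  shows "homogeneous_on_simplex D (\<lambda>t. g t + h t)"
proof -
  obtain p where
    "\<And>t. t \<in> std_simplex \<Longrightarrow> g t = (\<Sum>d\<in>multi_indices D. monomial_at d t *\<^sub>R p d)"
    using assms(1) by (rule homogeneous_on_simplexE) blast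
  moreover obtain q where
    "\<And>t. t \<in> std_simplex \<Longrightarrow> h t = (\<Sum>d\<in>multi_indices D. monomial_at d t *\<^sub>R q d)"
    using assms(2) by (rule homogeneous_on_simplexE) blast
  ultimately show ?thesis
    by (intro homogeneous_on_simplexI[where p = "\<lambda>d. p d + q d"])
       (simp add: scaleR_add_right sum.distrib)
qed

lemma homogeneous_on_simplex_sum:
  assumes "\<And>i. i \<in> I \<Longrightarrow> homogeneous_on_simplex D (g i)"
  shows "homogeneous_on_simplex D (\<lambda>t. \<Sum>i\<in>I. g i t)"
  using assms
  \<comment> \<open>Over an infinite \<open>I\<close> the sum is 0 by convention, so the zero map
    covers that case too.\<close>
  by (induction I rule: infinite_finite_induct)
     (simp_all add: homogeneous_on_simplex_0 homogeneous_on_simplex_add)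

text \<open>Multiplying monomials adds exponents, so the coefficients convolve. With scalar
  \<open>g\<close> and vector-valued \<open>h\<close> this serves products of polynomials, attaching
  fixed vectors to scalar components, and raising the degree.\<close>

lemma homogeneous_on_simplex_scaleR:
  assumes "homogeneous_on_simplex D g" "homogeneous_on_simplex E h"
  shows "homogeneous_on_simplex (D + E) (\<lambda>t. g t *\<^sub>R h t)"
proof -
  obtain c where
    c: "\<And>t. t \<in> std_simplex \<Longrightarrow> g t = (\<Sum>d\<in>multi_indices D. monomial_at d t *\<^sub>R c d)"
    using assms(1) by (rule homogeneous_on_simplexE) blast
  obtain q where
    q: "\<And>t. t \<in> std_simplex \<Longrightarrow> h t = (\<Sum>d\<in>multi_indices E. monomial_at d t *\<^sub>R q d)"
    using assms(2) by (rule homogeneous_on_simplexE) blast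
  define S :: "(('a \<Rightarrow> nat) \<times> ('a \<Rightarrow> nat)) set"
    where "S = multi_indices D \<times> multi_indices E"
  define add where "add = (\<lambda>(d :: 'a \<Rightarrow> nat, e) m. d m + e m)"
  have fin: "finite S"
    by (simp add: S_def finite_multi_indices)
  have img: "add ` S \<subseteq> multi_indices (D + E)"
    by (auto simp: S_def add_def multi_indices_def sum.distrib)
  have mon: "monomial_at (add de) t = monomial_at (fst de) t * monomial_at (snd de) t" for de t
    by (simp add: add_def monomial_at_def power_add prod.distrib split: prod.split)
  show ?thesis
  proof (rule homogeneous_on_simplexI)
    fix t :: "real ^ 'a" assume t: "t \<in> std_simplex"
    have "g t *\<^sub>R h t = (\<Sum>d\<in>multi_indices D. \<Sum>e\<in>multi_indices E.
        (monomial_at d t * monomial_at e t) *\<^sub>R (c d *\<^sub>R q e))"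
      unfolding c[OF t] q[OF t] scaleR_sum_left
      unfolding scaleR_sum_right by (simp add: mult_ac)
    also have "\<dots> = (\<Sum>de\<in>S. monomial_at (add de) t *\<^sub>R (c (fst de) *\<^sub>R q (snd de)))"
      by (simp add: S_def mon sum.cartesian_product case_prod_beta)
    \<comment> \<open>Pairs of exponents are collected by their sum \<open>k\<close>; all pairs in
      one fibre share the monomial of \<open>k\<close>.\<close>
    also have "\<dots> = (\<Sum>k\<in>multi_indices (D + E). \<Sum>de\<in>{de \<in> S. add de = k}.
        monomial_at (add de) t *\<^sub>R (c (fst de) *\<^sub>R q (snd de)))"
      by (rule sum.group[OF fin finite_multi_indices img, symmetric])
    also have "\<dots> = (\<Sum>k\<in>multi_indices (D + E). monomial_at k t *\<^sub>R
        (\<Sum>de\<in>{de \<in> S. add de = k}. c (fst de) *\<^sub>R q (snd de)))"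
      by (simp add: scaleR_sum_right)
    finally show "g t *\<^sub>R h t = (\<Sum>k\<in>multi_indices (D + E). monomial_at k t *\<^sub>R
        (\<Sum>de\<in>{de \<in> S. add de = k}. c (fst de) *\<^sub>R q (snd de)))" .
  qed
qed

section \<open>Polynomial maps as Bezier simplices\<close>

lemma homogeneous_on_simplex_const: "homogeneous_on_simplex 0 (\<lambda>t :: real ^ 'm::finite. v)"
proof -
  have "multi_indices 0 = {\<lambda>m :: 'm. 0 :: nat}"
    by (auto simp: multi_indices_def)
  then show ?thesis
    by (intro homogeneous_on_simplexI[where p = "\<lambda>d. v"]) (simp add: monomial_at_def)
qed

lemma homogeneous_on_simplex_coordinate:
  fixes m :: "'m::finite"
  shows "homogeneous_on_simplex 1 (\<lambda>t. t $ m)"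
proof -
  \<comment> \<open>\<open>u\<close> is the exponent of the single monomial \<open>t $ m\<close>;
    every other coefficient is 0.\<close>
  define u :: "'m \<Rightarrow> nat" where "u = (\<lambda>i. if i = m then 1 else 0)"
  have u: "u \<in> multi_indices 1"
    by (simp add: u_def multi_indices_def)
  have mon: "monomial_at u t = t $ m" for t
    by (simp add: u_def monomial_at_def if_distrib[where f = "\<lambda>n. _ ^ n"] cong: if_cong)
  show ?thesis
    by (rule homogeneous_on_simplexI[where p = "\<lambda>d. if d = u then 1 else 0"])
       (simp add: u mon finite_multi_indices if_distrib[where f = "\<lambda>x. _ * x"]
          del: One_nat_def cong: if_cong)
qed

lemma homogeneous_on_simplex_linear:
  fixes g :: "real ^ 'm::finite \<Rightarrow> 'b::real_vector"
  assumes "linear g"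
  shows "homogeneous_on_simplex 1 g"
proof -
  have "g = (\<lambda>t. \<Sum>m\<in>UNIV. t $ m *\<^sub>R g (axis m 1))"
  proof
    fix t
    have "g t = g (\<Sum>m\<in>UNIV. t $ m *\<^sub>R axis m 1)"
      using basis_expansion[of t] by (simp add: scalar_mult_eq_scaleR)
    then show "g t = (\<Sum>m\<in>UNIV. t $ m *\<^sub>R g (axis m 1))"
      by (simp add: linear_sum[OF assms] linear_cmul[OF assms])
  qed
  \<comment> \<open>The degree \<open>1 + 0\<close> reflects each summand: a coordinate of degree 1
    times a constant vector of degree 0.\<close>
  moreover have "homogeneous_on_simplex (1 + 0) (\<lambda>t. \<Sum>m\<in>UNIV. t $ m *\<^sub>R g (axis m 1))"
    by (intro homogeneous_on_simplex_sum homogeneous_on_simplex_scaleR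
        homogeneous_on_simplex_coordinate homogeneous_on_simplex_const)
  ultimately show ?thesis
    by simp
qed

text \<open>The coordinate sum is homogeneous of degree 1 and equals 1 on the simplex, so
  multiplying by it raises the degree by one without changing values there.\<close>

lemma homogeneous_on_simplex_elevate:
  fixes g :: "real ^ 'm::finite \<Rightarrow> 'b::real_vector"
  assumes "homogeneous_on_simplex D g" "D \<le> E"
  shows "homogeneous_on_simplex E g"
  using assms(2)
proof (induction E rule: dec_induct)
  case (step n)
  have "homogeneous_on_simplex 1 (\<lambda>t :: real ^ 'm. \<Sum>m\<in>UNIV. t $ m)"
    by (intro homogeneous_on_simplex_sum homogeneous_on_simplex_coordinate)
  then have "homogeneous_on_simplex (1 + n) (\<lambda>t. (\<Sum>m\<in>UNIV. t $ m) *\<^sub>R g t)"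
    using step.IH by (rule homogeneous_on_simplex_scaleR)
  then have "homogeneous_on_simplex (1 + n) g"
    by (rule homogeneous_on_simplex_cong) (simp add: std_simplex_def)
  then show ?case
    by simp
qed (fact assms(1))

text \<open>Induction on the generation of polynomials. Summands of different degrees are first
  elevated to the larger one; a product is \<open>scaleR\<close> on the reals.\<close>

lemma homogeneous_on_simplex_real_polynomial:
  fixes g :: "real ^ 'm::finite \<Rightarrow> real"
  assumes "real_polynomial_function g"
  shows "\<exists>D. homogeneous_on_simplex D g"
  using assms
proof induction
  case (linear g)
  then show ?case
    using homogeneous_on_simplex_linear bounded_linear.linear by blast
next
  case (const c)
  then show ?case
    using homogeneous_on_simplex_const by blast
next
  case (add g h)
  then obtain D E where "homogeneous_on_simplex D g" "homogeneous_on_simplex E h"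
    by blast
  then have "homogeneous_on_simplex (max D E) g" "homogeneous_on_simplex (max D E) h"
    by (auto elim: homogeneous_on_simplex_elevate)
  then show ?case
    using homogeneous_on_simplex_add by blast
next
  case (mult g h)
  then show ?case
    using homogeneous_on_simplex_scaleR[where h = h] by fastforce
qed

lemma polynomial_function_imp_bezier_simplex:
  fixes g :: "real ^ 'm::finite \<Rightarrow> 'b::euclidean_space"
  assumes "polynomial_function g"
  shows "is_bezier_simplex g"
proof -
  have "\<exists>D. homogeneous_on_simplex D (\<lambda>t. g t \<bullet> i)" if "i \<in> Basis" for i
    using assms that homogeneous_on_simplex_real_polynomial
    by (auto simp: polynomial_function_iff_Basis_inner)
  then obtain D where D: "\<And>i. i \<in> Basis \<Longrightarrow> homogeneous_on_simplex (D i) (\<lambda>t. g t \<bullet> i)"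
    by metis
  \<comment> \<open>The components may have different degrees; all are elevated to the maximum
    before being reassembled into one vector-valued map.\<close>
  define E where "E = Max (D ` (Basis :: 'b set))"
  have "homogeneous_on_simplex E (\<lambda>t. g t \<bullet> i)" if "i \<in> Basis" for i
    using D[OF that] that by (auto elim!: homogeneous_on_simplex_elevate simp: E_def)
  then have "homogeneous_on_simplex (E + 0) (\<lambda>t. \<Sum>i\<in>Basis. (g t \<bullet> i) *\<^sub>R i)"
    by (intro homogeneous_on_simplex_sum homogeneous_on_simplex_scaleR homogeneous_on_simplex_const)
  then show ?thesis
    by (simp add: euclidean_representation homogeneous_imp_bezier_simplex)
qed

section \<open>Uniform approximation and Hausdorff distance\<close>

lemma hausdorff_distance_image_le:
  assumes "\<And>t. t \<in> S \<Longrightarrow> dist (F t) (G t) \<le> e"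
  shows "hausdorff_distance (F ` S) (G ` S) \<le> ennreal e"
  unfolding hausdorff_distance_def
proof (rule max.boundedI)
  \<comment> \<open>The point \<open>F t\<close> is paired with \<open>G t\<close> for the same
    parameter, which bounds its infimum by \<open>e\<close>; the same pairing gives the reverse
    direction.\<close>
  show "(SUP a\<in>F ` S. INF b\<in>G ` S. ennreal (dist a b)) \<le> ennreal e"
    using assms by (auto intro!: SUP_least INF_lower2 ennreal_leI)
  show "(SUP b\<in>G ` S. INF a\<in>F ` S. ennreal (dist a b)) \<le> ennreal e"
    using assms by (auto intro!: SUP_least INF_lower2 ennreal_leI)
qed

lemma compact_std_simplex: "compact (std_simplex :: (real ^ 'm::finite) set)"
proof -
  have "closed (std_simplex :: (real ^ 'm) set)"
    unfolding std_simplex_def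
    by (intro closed_Collect_conj closed_Collect_all closed_Collect_le closed_Collect_eq
        continuous_intros)
  \<comment> \<open>Nonnegative coordinates with sum 1 are each at most 1.\<close>
  moreover have "std_simplex \<subseteq> cbox (0 :: real ^ 'm) 1"
  proof
    fix t :: "real ^ 'm" assume t: "t \<in> std_simplex"
    have "t $ m \<le> (\<Sum>i\<in>UNIV. t $ i)" for m
      using t by (intro member_le_sum) (auto simp: std_simplex_def)
    with t show "t \<in> cbox 0 1"
      by (simp add: std_simplex_def mem_box_cart)
  qed
  ultimately show ?thesis
    using bounded_cbox bounded_subset compact_eq_bounded_closed by blast
qed

lemma bezier_simplices_approximate:
  fixes F :: "real ^ 'm::finite \<Rightarrow> 'b::euclidean_space"
  assumes "continuous_on std_simplex F"
  shows "\<exists>b :: nat \<Rightarrow> real ^ 'm \<Rightarrow> 'b. (\<forall>i. is_bezier_simplex (b i)) \<and>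
    (\<lambda>i. hausdorff_distance (F ` std_simplex) (b i ` std_simplex)) \<longlonglongrightarrow> 0"
proof -
  \<comment> \<open>Stone-Weierstrass on the compact simplex; the tolerance uses
    \<open>Suc i\<close> so that it is positive for \<open>i = 0\<close> as well.\<close>
  have "\<exists>g. polynomial_function g \<and> (\<forall>t\<in>std_simplex. norm (F t - g t) < 1 / real (Suc i))" for i
    using assms by (intro Stone_Weierstrass_polynomial_function compact_std_simplex) auto
  then obtain b where poly: "\<And>i. polynomial_function (b i)"
    and b: "\<And>i t. t \<in> std_simplex \<Longrightarrow> norm (F t - b i t) < 1 / real (Suc i)"
    by metis
  have le: "hausdorff_distance (F ` std_simplex) (b i ` std_simplex) \<le> ennreal (1 / real (Suc i))"
    for i
    using b by (intro hausdorff_distance_image_le) (auto simp: dist_norm less_imp_le)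
  have "(\<lambda>i. 1 / real (Suc i)) \<longlonglongrightarrow> 0"
    using LIMSEQ_inverse_real_of_nat by (simp add: inverse_eq_divide)
  then have lim: "(\<lambda>i. ennreal (1 / real (Suc i))) \<longlonglongrightarrow> 0"
    using tendsto_ennrealI by fastforce
  have "(\<lambda>i. hausdorff_distance (F ` std_simplex) (b i ` std_simplex)) \<longlonglongrightarrow> 0"
    by (rule tendsto_sandwich[OF _ _ tendsto_const lim]) (simp_all add: le del: of_nat_Suc)
  then show ?thesis
    using poly polynomial_function_imp_bezier_simplex by blast
qed

theorem corollary2:
  fixes X :: "(real ^ 'l::finite) set" and f :: "real ^ 'l \<Rightarrow> real ^ 'm::finite"
  assumes "simplicial_problem X f"
  shows "(\<exists>b :: nat \<Rightarrow> real ^ 'm \<Rightarrow> real ^ 'l. (\<forall>i. is_bezier_simplex (b i)) \<and>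
            (\<lambda>i. hausdorff_distance (pareto_set UNIV X f) (b i ` std_simplex)) \<longlonglongrightarrow> 0)
       \<and> (\<exists>b :: nat \<Rightarrow> real ^ 'm \<Rightarrow> real ^ 'm. (\<forall>i. is_bezier_simplex (b i)) \<and>
            (\<lambda>i. hausdorff_distance (f ` pareto_set UNIV X f) (b i ` std_simplex)) \<longlonglongrightarrow> 0)
       \<and> (\<exists>b :: nat \<Rightarrow> real ^ 'm \<Rightarrow> (real ^ 'l) \<times> (real ^ 'm). (\<forall>i. is_bezier_simplex (b i)) \<and>
            (\<lambda>i. hausdorff_distance (pareto_graph X f) (b i ` std_simplex)) \<longlonglongrightarrow> 0)"
proof -
  obtain \<phi> \<psi> \<psi>' where
    \<phi>: "homeomorphism (simplex_face (UNIV :: 'm set)) (pareto_set UNIV X f) \<phi> \<psi>" and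
    f\<phi>: "homeomorphism (simplex_face (UNIV :: 'm set)) (f ` pareto_set UNIV X f) (f \<circ> \<phi>) \<psi>'"
    using assms unfolding simplicial_problem_def by blast
  have face: "simplex_face UNIV = (std_simplex :: (real ^ 'm) set)"
    by (simp add: simplex_face_def)
  \<comment> \<open>Continuity of \<open>f\<close> is not assumed: that of
    \<open>f \<circ> \<phi>\<close> comes from the second homeomorphism, the one onto the
    front.\<close>
  have cont: "continuous_on std_simplex \<phi>" "continuous_on std_simplex (f \<circ> \<phi>)"
    using homeomorphism_cont1[OF \<phi>] homeomorphism_cont1[OF f\<phi>] by (simp_all add: face)
  have set_eq: "pareto_set UNIV X f = \<phi> ` std_simplex"
    using homeomorphism_image1[OF \<phi>] by (simp add: face)
  then have front_eq: "f ` pareto_set UNIV X f = (f \<circ> \<phi>) ` std_simplex"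
    by (simp add: image_comp)
  have graph_eq: "pareto_graph X f = (\<lambda>t. (\<phi> t, (f \<circ> \<phi>) t)) ` std_simplex"
    by (auto simp: pareto_graph_def set_eq)
  have "continuous_on std_simplex (\<lambda>t. (\<phi> t, (f \<circ> \<phi>) t))"
    using cont by (intro continuous_on_Pair)
  with cont show ?thesis
    \<comment> \<open>The front is rewritten first, because \<open>set_eq\<close> would replace the
      Pareto set inside it and \<open>front_eq\<close> would no longer match.\<close>
    unfolding front_eq graph_eq unfolding set_eq
    by (intro conjI bezier_simplices_approximate)
qed

end
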